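(* For every fixed integer $d\ge 2$ there is a constant $c_d>0$ (depending only on $d$) such that for infinitely many values of $n$ there exists an $n$-point set $P\subset\mathbb{R}^d$ with \[ \operatorname{disc}\mathcal{R}_d(P)\ge c_d\log^{d-1}n . \]
   Context: $\mathcal{R}_d$ denotes the family of all axis-parallel boxes $[a_1,b_1]\times\cdots\times[a_d,b_d]$ in $\mathbb{R}^d$, and $\mathcal{R}_d(P)=\{R\cap P: R\in\mathcal{R}_d\}$ is the set system on ground set $P$ induced by them. For a set system $\mathcal{F}$ on a finite ground set $V$, its (combinatorial) discrepancy is $\operatorname{disc}\mathcal{F}=\min_{x\in\{-1,1\}^V}\max_{F\in\mathcal{F}}\bigl|\sum_{v\in F}x_v\bigr|$. *)

theory Defs
  imports "HOL-Analysis.Analysis"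
begin

text \<open>Points of R^d are represented as functions nat => real that vanish
outside the coordinates 0..d-1.\<close>

definition pts :: "nat \<Rightarrow> (nat \<Rightarrow> real) set" where
  "pts d = {x. \<forall>i\<ge>d. x i = 0}"

definition axis_box :: "nat \<Rightarrow> (nat \<Rightarrow> real) \<Rightarrow> (nat \<Rightarrow> real) \<Rightarrow> (nat \<Rightarrow> real) set" where
  "axis_box d a b = {x \<in> pts d. \<forall>i<d. a i \<le> x i \<and> x i \<le> b i}"

definition rect_system :: "nat \<Rightarrow> (nat \<Rightarrow> real) set \<Rightarrow> (nat \<Rightarrow> real) set set" where
  "rect_system d P = {axis_box d a b \<inter> P | a b. True}"

definition disc :: "'a set \<Rightarrow> 'a set set \<Rightarrow> real" where
  "disc V F = (INF x\<in>{x. \<forall>v\<in>V. x v \<in> {-1, 1::int}}.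
                  (SUP S\<in>F. \<bar>real_of_int (\<Sum>v\<in>S. x v)\<bar>))"

end

theory Submission
  imports Defs
begin

text \<open>
The grid \<open>{0..<M}\<^sup>d\<close> is tested against the sign vectors
\<open>\<Prod>i. threshold_sign (q i) (p i)\<close>, each a \<open>\<plusminus>1\<close> combination of \<open>2\<^sup>d\<close> boxes. In one dimension this matrix
has explicit singular vectors (cosines and sines of odd frequency \<open>\<xi>\<close>) and singular values of order
\<open>M / \<xi>\<close>, so its \<open>d\<close>-th tensor power has \<open>K \<ge> const \<cdot> M (log M)\<^bsup>d-1\<^esup>\<close> singular values of size at least
\<open>\<sigma> = const \<cdot> M\<^bsup>d-1\<^esup>\<close>, one for each tuple of odd frequencies with product at most \<open>M\<close>.

Hence projecting away fewer than \<open>K/2\<close> dimensions leaves squared Frobenius norm at least \<open>\<sigma>\<^sup>2 K/2\<close>, and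
columns can be chosen greedily, about \<open>K/2\<close> of them, each at distance at least
\<open>\<delta> = \<sigma> (K / (2 M\<^sup>d))\<^bsup>1/2\<^esup>\<close> from the span of its predecessors. If every subset of the chosen columns had
a colouring of discrepancy at most \<open>D\<close>, every dyadic point of the unit cube could be rounded to a vertex
with error at most \<open>D\<close>; counting lattice points near a vertex with a Gaussian weight, one coordinate at
a time along the triangular system, rules this out unless \<open>D\<^sup>2 M\<^sup>d \<ge> const \<cdot> K \<delta>\<^sup>2\<close>, that is
\<open>D \<ge> const \<cdot> (log M)\<^bsup>d-1\<^esup>\<close>.
\<close>

subsection \<open>Orthonormal families and greedy column selection\<close>

definition dotp :: "'q set \<Rightarrow> ('q \<Rightarrow> real) \<Rightarrow> ('q \<Rightarrow> real) \<Rightarrow> real" where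
  "dotp R f g = (\<Sum>q\<in>R. f q * g q)"

definition orthonormal_on :: "'q set \<Rightarrow> 'j set \<Rightarrow> ('j \<Rightarrow> 'q \<Rightarrow> real) \<Rightarrow> bool" where
  "orthonormal_on R J e \<longleftrightarrow> (\<forall>i\<in>J. \<forall>j\<in>J. dotp R (e i) (e j) = (if i = j then 1 else 0))"

lemma dotp_commute: "dotp R f g = dotp R g f"
  by (simp add: dotp_def mult.commute)

lemma dotp_diff_left: "dotp R (\<lambda>q. f q - g q) h = dotp R f h - dotp R g h"
  by (simp add: dotp_def left_diff_distrib sum_subtractf)

lemma dotp_scale_left: "dotp R (\<lambda>q. a * f q) h = a * dotp R f h"
  by (simp add: dotp_def sum_distrib_left mult.assoc)

lemma dotp_sum_left: "dotp R (\<lambda>q. \<Sum>j\<in>J. f j q) h = (\<Sum>j\<in>J. dotp R (f j) h)"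
  by (simp add: dotp_def sum_distrib_right sum.swap[of _ J])

lemma dotp_diff_right: "dotp R h (\<lambda>q. f q - g q) = dotp R h f - dotp R h g"
  by (simp add: dotp_commute[of _ h] dotp_diff_left)

lemma dotp_scale_right: "dotp R h (\<lambda>q. a * f q) = a * dotp R h f"
  by (simp add: dotp_commute[of _ h] dotp_scale_left)

lemma dotp_sum_right: "dotp R h (\<lambda>q. \<Sum>j\<in>J. f j q) = (\<Sum>j\<in>J. dotp R h (f j))"
  by (simp add: dotp_commute[of _ h] dotp_sum_left)

lemma dotp_self_nonneg: "0 \<le> dotp R f f"
  by (simp add: dotp_def sum_nonneg)

lemma dotp_cong: "(\<And>q. q \<in> R \<Longrightarrow> f q = f' q) \<Longrightarrow> dotp R f g = dotp R f' g"
  by (simp add: dotp_def)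

text \<open>For orthonormal \<open>e\<close> this is the component of \<open>f\<close> orthogonal to
  the span of the \<open>e j\<close>; its norm is the distance of \<open>f\<close> from that
  span.\<close>

definition residual :: "'q set \<Rightarrow> 'j set \<Rightarrow> ('j \<Rightarrow> 'q \<Rightarrow> real) \<Rightarrow> ('q \<Rightarrow> real) \<Rightarrow> 'q \<Rightarrow> real" where
  "residual R J e f q = f q - (\<Sum>j\<in>J. dotp R f (e j) * e j q)"

lemma residual_orthogonal:
  assumes "finite J" "orthonormal_on R J e" "l \<in> J"
  shows "dotp R (residual R J e f) (e l) = 0"
proof -
  have "(\<Sum>j\<in>J. dotp R f (e j) * dotp R (e j) (e l)) = (\<Sum>j\<in>J. if j = l then dotp R f (e l) else 0)"
    using assms by (intro sum.cong) (auto simp: orthonormal_on_def)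
  then show ?thesis
    using assms by (simp add: residual_def[abs_def] dotp_diff_left dotp_sum_left dotp_scale_left)
qed

lemma dotp_residual_residual:
  assumes "finite J" "orthonormal_on R J e"
  shows "dotp R (residual R J e f) (residual R J e f) = dotp R f (residual R J e f)"
proof -
  let ?r = "residual R J e f"
  have "dotp R ?r ?r = dotp R f ?r - (\<Sum>j\<in>J. dotp R f (e j) * dotp R (e j) ?r)"
    by (subst residual_def[abs_def]) (simp add: dotp_diff_left dotp_sum_left dotp_scale_left)
  also have "(\<Sum>j\<in>J. dotp R f (e j) * dotp R (e j) ?r) = 0"
    using residual_orthogonal[OF assms] by (intro sum.neutral) (simp add: dotp_commute)
  finally show ?thesis by simp
qed

lemma residual_norm:
  assumes "finite J" "orthonormal_on R J e"
  shows "dotp R (residual R J e f) (residual R J e f) = dotp R f f - (\<Sum>j\<in>J. (dotp R f (e j))\<^sup>2)"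
  unfolding dotp_residual_residual[OF assms]
  by (simp add: residual_def[abs_def] dotp_diff_right dotp_sum_right dotp_scale_right power2_eq_square)

lemma bessel:
  assumes "finite J" "orthonormal_on R J e"
  shows "(\<Sum>j\<in>J. (dotp R f (e j))\<^sup>2) \<le> dotp R f f"
  using residual_norm[OF assms, of f] dotp_self_nonneg[of R "residual R J e f"] by simp

text \<open>Averaging and Gram-Schmidt: by \<open>res\<close> the mean squared distance of the
  columns from the span of any \<open>i < k\<close> orthonormal vectors is at least
  \<open>\<delta>\<^sup>2\<close>, so some column is that far away, and its normalised residual
  becomes the next vector. Earlier columns lie in the span of earlier vectors, hence the zeros below
  the diagonal.\<close>

lemma greedy_triangular_system:
  fixes v :: "'c \<Rightarrow> 'q \<Rightarrow> real" and k :: nat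
  assumes C: "finite C" "C \<noteq> {}" and \<delta>: "\<delta> > 0"
    and res: "\<And>i e. i < k \<Longrightarrow> orthonormal_on R {..<i} e \<Longrightarrow>
      real (card C) * \<delta>\<^sup>2 \<le> (\<Sum>p\<in>C. dotp R (residual R {..<i} e (v p)) (residual R {..<i} e (v p)))"
  shows "\<exists>c e. c ` {..<k} \<subseteq> C \<and> orthonormal_on R {..<k} e \<and>
    (\<forall>i<k. \<forall>j<i. dotp R (v (c j)) (e i) = 0) \<and> (\<forall>i<k. \<delta> \<le> dotp R (v (c i)) (e i))"
proof -
  \<comment> \<open>The induction needs one more invariant, the last conjunct: on \<open>R\<close>,
    the chosen columns lie in the span of the vectors built so far.\<close>
  have "\<exists>c e. c ` {..<i} \<subseteq> C \<and> orthonormal_on R {..<i} e \<and>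
    (\<forall>i'<i. \<forall>j<i'. dotp R (v (c j)) (e i') = 0) \<and> (\<forall>i'<i. \<delta> \<le> dotp R (v (c i')) (e i')) \<and>
    (\<forall>j<i. \<forall>q\<in>R. residual R {..<i} e (v (c j)) q = 0)" if "i \<le> k" for i
    using that
  proof (induction i)
    case 0
    then show ?case by (auto simp: orthonormal_on_def)
  next
    case (Suc i)
    then obtain c e where c: "c ` {..<i} \<subseteq> C" and on: "orthonormal_on R {..<i} e"
      and tri: "\<And>i' j. i' < i \<Longrightarrow> j < i' \<Longrightarrow> dotp R (v (c j)) (e i') = 0"
      and dia: "\<And>i'. i' < i \<Longrightarrow> \<delta> \<le> dotp R (v (c i')) (e i')"
      and spn: "\<And>j q. j < i \<Longrightarrow> q \<in> R \<Longrightarrow> residual R {..<i} e (v (c j)) q = 0"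
      by (metis Suc_leD)
    have "\<exists>p\<in>C. \<delta>\<^sup>2 \<le> dotp R (residual R {..<i} e (v p)) (residual R {..<i} e (v p))"
    proof (rule ccontr)
      assume "\<not> ?thesis"
      then have "(\<Sum>p\<in>C. dotp R (residual R {..<i} e (v p)) (residual R {..<i} e (v p))) < (\<Sum>p\<in>C. \<delta>\<^sup>2)"
        using C by (intro sum_strict_mono) auto
      then show False using res[OF _ on] Suc.prems by simp
    qed
    then obtain p where p: "p \<in> C"
      and "\<delta>\<^sup>2 \<le> dotp R (residual R {..<i} e (v p)) (residual R {..<i} e (v p))" by blast
    define r where "r = residual R {..<i} e (v p)"
    define \<rho> where "\<rho> = sqrt (dotp R r r)"
    have \<rho>: "\<rho>\<^sup>2 = dotp R r r" by (simp add: \<rho>_def dotp_self_nonneg)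
    have \<rho>\<delta>: "\<delta> \<le> \<rho>"
      using \<open>\<delta>\<^sup>2 \<le> _\<close> \<delta> unfolding \<rho>_def r_def[symmetric] by (simp add: real_le_rsqrt)
    then have \<rho>0: "\<rho> > 0" using \<delta> by simp
    define e' where "e' = e(i := (\<lambda>q. inverse \<rho> * r q))"
    define c' where "c' = c(i := p)"
    have e'i: "e' i = (\<lambda>q. inverse \<rho> * r q)" and e'l: "\<And>l. l < i \<Longrightarrow> e' l = e l"
      by (auto simp: e'_def)
    have c'i: "c' i = p" and c'l: "\<And>l. l < i \<Longrightarrow> c' l = c l"
      by (auto simp: c'_def)
    have re: "dotp R r (e l) = 0" "dotp R (e l) r = 0" if "l < i" for l
      using residual_orthogonal[OF _ on, of l "v p"] that by (auto simp: r_def dotp_commute)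
    have vr: "dotp R (v p) r = \<rho>\<^sup>2"
      using dotp_residual_residual[OF _ on, of "v p"] \<rho> by (simp add: r_def)
    have "inverse \<rho> * (inverse \<rho> * (\<rho> * \<rho>)) = 1" using \<rho>0 by (simp add: field_simps)
    then have on': "orthonormal_on R {..<Suc i} e'"
      using on re \<rho>0 unfolding orthonormal_on_def
      by (auto simp: less_Suc_eq e'i e'l dotp_scale_left dotp_scale_right \<rho>[symmetric] power2_eq_square)
    \<comment> \<open>By the invariant \<open>v (c j)\<close> is a combination of the
      \<open>e l\<close> with \<open>l < i\<close>, all orthogonal to \<open>r\<close>.\<close>
    have vj: "dotp R (v (c j)) (e' i) = 0" if "j < i" for j
    proof -
      have "dotp R (v (c j)) r = dotp R (\<lambda>q. \<Sum>l<i. dotp R (v (c j)) (e l) * e l q) r"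
        using spn[OF that] by (intro dotp_cong) (simp add: residual_def)
      also have "\<dots> = 0" using re by (simp add: dotp_sum_left dotp_scale_left)
      finally show ?thesis by (simp add: e'i dotp_scale_right)
    qed
    have vi: "dotp R (v p) (e' i) = \<rho>"
      using vr \<rho>0 by (simp add: e'i dotp_scale_right power2_eq_square)
    have split: "residual R {..<Suc i} e' f q = residual R {..<i} e f q - dotp R f (e' i) * e' i q" for f q
      by (simp add: residual_def e'l)
    have spn': "residual R {..<Suc i} e' (v (c' j)) q = 0" if "j < Suc i" "q \<in> R" for j q
      using that spn vj vi \<rho>0
      by (auto simp: split less_Suc_eq c'l c'i e'i r_def[symmetric])
    have "c' ` {..<Suc i} \<subseteq> C" using c p by (auto simp: less_Suc_eq c'l c'i image_subset_iff)
    moreover have "\<forall>i'<Suc i. \<forall>j<i'. dotp R (v (c' j)) (e' i') = 0"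
      using tri vj by (auto simp: less_Suc_eq c'l e'l)
    moreover have "\<forall>i'<Suc i. \<delta> \<le> dotp R (v (c' i')) (e' i')"
      using dia vi \<rho>\<delta> by (auto simp: less_Suc_eq c'l c'i e'l)
    ultimately show ?case using on' spn' by blast
  qed
  from this[of k] show ?thesis by blast
qed

text \<open>\<open>v\<close> is a matrix with columns \<open>p \<in> C\<close> and rows
  \<open>q \<in> R\<close>; \<open>u\<close> and \<open>h\<close> are singular vectors,
  \<open>lam\<close> the singular values up to sign. After projecting the columns, the image of
  \<open>u \<xi>\<close> is \<open>lam \<xi>\<close> times the projected \<open>h \<xi>\<close>. The
  squared norms of the projected \<open>h \<xi>\<close> sum to at least
  \<open>card F - card I\<close>, and Bessel for \<open>u\<close> in each row bounds the images by
  the squared Frobenius norm.\<close>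

lemma spectral_residual_bound:
  assumes fin: "finite F" "finite I"
    and u: "orthonormal_on C F u" and h: "orthonormal_on R F h" and e: "orthonormal_on R I e"
    and eig: "\<And>\<xi> q. \<xi> \<in> F \<Longrightarrow> q \<in> R \<Longrightarrow> dotp C (\<lambda>p. v p q) (u \<xi>) = lam \<xi> * h \<xi> q"
    and \<sigma>: "0 \<le> \<sigma>" "\<And>\<xi>. \<xi> \<in> F \<Longrightarrow> \<sigma> \<le> \<bar>lam \<xi>\<bar>"
  shows "\<sigma>\<^sup>2 * (real (card F) - real (card I)) \<le>
    (\<Sum>p\<in>C. dotp R (residual R I e (v p)) (residual R I e (v p)))"
proof -
  let ?r = "\<lambda>p. residual R I e (v p)"
  \<comment> \<open>The projection is linear, so it commutes with combining columns.\<close>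
  have tr: "dotp C (\<lambda>p. ?r p q) (u \<xi>) = lam \<xi> * residual R I e (h \<xi>) q"
    if \<xi>: "\<xi> \<in> F" and q: "q \<in> R" for \<xi> q
  proof -
    have ej: "(\<Sum>p\<in>C. dotp R (v p) (e j) * u \<xi> p) = lam \<xi> * dotp R (h \<xi>) (e j)" for j
    proof -
      have "(\<Sum>p\<in>C. dotp R (v p) (e j) * u \<xi> p) = (\<Sum>q\<in>R. dotp C (\<lambda>p. v p q) (u \<xi>) * e j q)"
        by (simp add: dotp_def sum_distrib_left sum_distrib_right sum.swap[of _ C] mult_ac)
      also have "\<dots> = (\<Sum>q\<in>R. lam \<xi> * h \<xi> q * e j q)"
        using eig[OF \<xi>] by simp
      finally show ?thesis by (simp add: dotp_def sum_distrib_left mult_ac)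
    qed
    have "dotp C (\<lambda>p. ?r p q) (u \<xi>) =
      dotp C (\<lambda>p. v p q) (u \<xi>) - (\<Sum>p\<in>C. \<Sum>j\<in>I. dotp R (v p) (e j) * e j q * u \<xi> p)"
      by (simp add: residual_def dotp_def left_diff_distrib sum_subtractf sum_distrib_right)
    also have "(\<Sum>p\<in>C. \<Sum>j\<in>I. dotp R (v p) (e j) * e j q * u \<xi> p) =
      (\<Sum>j\<in>I. (\<Sum>p\<in>C. dotp R (v p) (e j) * u \<xi> p) * e j q)"
      by (subst sum.swap) (simp add: sum_distrib_left sum_distrib_right mult_ac)
    also have "\<dots> = (\<Sum>j\<in>I. lam \<xi> * (dotp R (h \<xi>) (e j) * e j q))"
      by (simp only: ej mult.assoc)
    finally show ?thesis
      by (simp add: eig[OF \<xi> q] residual_def[of R I e "h \<xi>"] right_diff_distrib sum_distrib_left)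
  qed
  \<comment> \<open>Double counting: the components of each unit vector \<open>e j\<close> along the
    orthonormal \<open>h\<close> have squares summing to at most 1.\<close>
  have hb: "(\<Sum>\<xi>\<in>F. \<Sum>j\<in>I. (dotp R (h \<xi>) (e j))\<^sup>2) \<le> real (card I)"
  proof -
    have "(\<Sum>\<xi>\<in>F. \<Sum>j\<in>I. (dotp R (h \<xi>) (e j))\<^sup>2) = (\<Sum>j\<in>I. \<Sum>\<xi>\<in>F. (dotp R (e j) (h \<xi>))\<^sup>2)"
      by (subst sum.swap) (simp add: dotp_commute)
    also have "\<dots> \<le> (\<Sum>j\<in>I. dotp R (e j) (e j))"
      by (intro sum_mono bessel fin h)
    also have "\<dots> = real (card I)" using e by (simp add: orthonormal_on_def)
    finally show ?thesis .
  qed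
  have "\<sigma>\<^sup>2 * (real (card F) - real (card I)) \<le>
    \<sigma>\<^sup>2 * (\<Sum>\<xi>\<in>F. 1 - (\<Sum>j\<in>I. (dotp R (h \<xi>) (e j))\<^sup>2))"
    using hb by (intro mult_left_mono) (simp_all add: sum_subtractf)
  also have "\<dots> = (\<Sum>\<xi>\<in>F. \<sigma>\<^sup>2 * dotp R (residual R I e (h \<xi>)) (residual R I e (h \<xi>)))"
    using h by (simp add: residual_norm[OF fin(2) e] sum_distrib_left orthonormal_on_def)
  also have "\<dots> \<le> (\<Sum>\<xi>\<in>F. (lam \<xi>)\<^sup>2 * dotp R (residual R I e (h \<xi>)) (residual R I e (h \<xi>)))"
    using \<sigma> by (intro sum_mono mult_right_mono dotp_self_nonneg)
      (metis abs_le_square_iff abs_of_nonneg)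
  also have "\<dots> = (\<Sum>\<xi>\<in>F. \<Sum>q\<in>R. (dotp C (\<lambda>p. ?r p q) (u \<xi>))\<^sup>2)"
    by (intro sum.cong refl)
      (simp add: tr dotp_def[of R "residual _ _ _ _"] sum_distrib_left power2_eq_square mult_ac)
  also have "\<dots> = (\<Sum>q\<in>R. \<Sum>\<xi>\<in>F. (dotp C (\<lambda>p. ?r p q) (u \<xi>))\<^sup>2)"
    by (rule sum.swap)
  also have "\<dots> \<le> (\<Sum>q\<in>R. dotp C (\<lambda>p. ?r p q) (\<lambda>p. ?r p q))"
    by (intro sum_mono bessel fin u)
  also have "\<dots> = (\<Sum>p\<in>C. dotp R (?r p) (?r p))"
    by (simp add: dotp_def sum.swap[of _ C])
  finally show ?thesis .
qed

subsection \<open>Hereditary discrepancy of a triangular system\<close>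

text \<open>Binary digits are removed from the last one on. Colouring the coordinates with odd
  numerator moves them by \<open>1 / 2 ^ r\<close>, at cost at most \<open>D / 2 ^ r\<close> in each
  row, and makes all numerators even. The costs form a geometric series with sum
  \<open>D * (1 - 1 / 2 ^ r)\<close>.\<close>

lemma dyadic_rounding:
  fixes v :: "'c \<Rightarrow> 'q \<Rightarrow> real"
  assumes J: "finite J"
    and col: "\<And>S. S \<subseteq> J \<Longrightarrow> \<exists>x. (\<forall>j\<in>S. x j \<in> {-1, 1::int}) \<and> (\<forall>q\<in>R. \<bar>\<Sum>j\<in>S. x j * v j q\<bar> \<le> D)"
    and w: "\<And>j. j \<in> J \<Longrightarrow> w j \<le> (2::nat) ^ r"
  shows "\<exists>y. (\<forall>j\<in>J. y j \<le> (1::nat)) \<and>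
    (\<forall>q\<in>R. \<bar>\<Sum>j\<in>J. (w j / 2 ^ r - y j) * v j q\<bar> \<le> D * (1 - 1 / 2 ^ r))"
  using w
proof (induction r arbitrary: w)
  case 0
  then show ?case by (intro exI[of _ w]) auto
next
  case (Suc r)
  define S where "S = {j\<in>J. odd (w j)}"
  obtain x where x: "\<And>j. j \<in> S \<Longrightarrow> x j = -1 \<or> x j = (1::int)"
    and xD: "\<And>q. q \<in> R \<Longrightarrow> \<bar>\<Sum>j\<in>S. x j * v j q\<bar> \<le> D"
    using col[of S] by (auto simp: S_def)
  \<comment> \<open>This is \<open>(w j + x j) / 2\<close> on \<open>S\<close> and
    \<open>w j / 2\<close> elsewhere; for odd \<open>w j\<close> and \<open>x j = -1\<close> the
    truncating division gives the right value.\<close>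
  define w' where "w' j = (if odd (w j) \<and> x j = 1 then (w j + 1) div 2 else w j div 2)" for j
  have w': "w' j \<le> 2 ^ r" if "j \<in> J" for j
    using Suc.prems[OF that] by (auto simp: w'_def elim!: oddE)
  obtain y where y: "\<And>j. j \<in> J \<Longrightarrow> y j \<le> (1::nat)"
    and yD: "\<And>q. q \<in> R \<Longrightarrow> \<bar>\<Sum>j\<in>J. (w' j / 2 ^ r - y j) * v j q\<bar> \<le> D * (1 - 1 / 2 ^ r)"
    using Suc.IH[of w'] w' by blast
  have w2: "real (w j) = 2 * real (w' j) - (if j \<in> S then x j else 0)" if "j \<in> J" for j
    using that x[of j] by (auto simp: w'_def S_def elim!: oddE evenE)
  have "\<bar>\<Sum>j\<in>J. (w j / 2 ^ Suc r - y j) * v j q\<bar> \<le> D * (1 - 1 / 2 ^ Suc r)" if q: "q \<in> R" for q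
  proof -
    have "(\<Sum>j\<in>J. (w j / 2 ^ Suc r - y j) * v j q) =
      (\<Sum>j\<in>J. (w' j / 2 ^ r - y j) * v j q - (if j \<in> S then x j * v j q else 0) / 2 ^ Suc r)"
      by (intro sum.cong refl) (auto simp: w2 field_simps)
    also have "\<dots> = (\<Sum>j\<in>J. (w' j / 2 ^ r - y j) * v j q) - (\<Sum>j\<in>J. if j \<in> S then x j * v j q else 0) / 2 ^ Suc r"
      by (simp only: sum_subtractf sum_divide_distrib)
    also have "(\<Sum>j\<in>J. if j \<in> S then x j * v j q else 0) = (\<Sum>j\<in>S. x j * v j q)"
      using J by (subst sum.inter_restrict[symmetric]) (auto simp: S_def Int_def intro!: sum.cong)
    finally have eq: "(\<Sum>j\<in>J. (w j / 2 ^ Suc r - y j) * v j q) =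
      (\<Sum>j\<in>J. (w' j / 2 ^ r - y j) * v j q) - (\<Sum>j\<in>S. x j * v j q) / 2 ^ Suc r" .
    have "\<bar>(\<Sum>j\<in>S. x j * v j q) / 2 ^ Suc r\<bar> \<le> D / 2 ^ Suc r"
      using xD[OF q] by (simp add: divide_right_mono)
    then have "\<bar>\<Sum>j\<in>J. (w j / 2 ^ Suc r - y j) * v j q\<bar> \<le> D * (1 - 1 / 2 ^ r) + D / 2 ^ Suc r"
      unfolding eq using yD[OF q] by linarith
    also have "\<dots> = D * (1 - 1 / 2 ^ Suc r)" by (simp add: field_simps)
    finally show ?thesis .
  qed
  then show ?case using y by blast
qed

text \<open>Row \<open>i\<close> involves only the coordinates \<open>j \<ge> i\<close>, so the last
  row depends on the last coordinate alone. Fixing that coordinate merely shifts the offsets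
  \<open>b\<close> of the other rows; this is why \<open>b\<close> is arbitrary in the induction and
  \<open>Q\<close> must be uniform in the shift \<open>c\<close>.\<close>

lemma triangular_sum_bound:
  fixes g :: "real \<Rightarrow> real" and L :: "nat \<Rightarrow> nat \<Rightarrow> real" and s :: "nat \<Rightarrow> real"
  assumes g: "\<And>x. 0 \<le> g x"
    and Q: "\<And>i c. i < k \<Longrightarrow> (\<Sum>t\<in>T. g (c + s t * L i i)) \<le> Q"
    and L: "\<And>i j. i < k \<Longrightarrow> j < i \<Longrightarrow> L i j = 0"
  shows "(\<Sum>w\<in>PiE {..<k} (\<lambda>_. T). \<Prod>i<k. g (b i + (\<Sum>j<k. s (w j) * L i j))) \<le> Q ^ k"
  using Q L
proof (induction k arbitrary: b)
  case 0
  then show ?case by simp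
next
  case (Suc k)
  have Q0: "0 \<le> Q"
    using Suc.prems(1)[of 0 0] sum_nonneg[of T "\<lambda>t. g (0 + s t * L 0 0)"] g by force
  have set: "PiE {..<Suc k} (\<lambda>_. T) = (\<lambda>(t, w). w(k := t)) ` (T \<times> PiE {..<k} (\<lambda>_. T))"
    by (simp add: lessThan_Suc PiE_insert_eq)
  have inj: "inj_on (\<lambda>(t, w). w(k := t)) (T \<times> PiE {..<k} (\<lambda>_. T))"
    by (rule inj_combinator) simp
  have "(\<Sum>w\<in>PiE {..<Suc k} (\<lambda>_. T). \<Prod>i<Suc k. g (b i + (\<Sum>j<Suc k. s (w j) * L i j))) =
    (\<Sum>(t, w)\<in>T \<times> PiE {..<k} (\<lambda>_. T).
      g (b k + s t * L k k) * (\<Prod>i<k. g ((b i + s t * L i k) + (\<Sum>j<k. s (w j) * L i j))))"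
    unfolding set
  proof (subst sum.reindex[OF inj], intro sum.cong refl, clarsimp simp del: sum.lessThan_Suc fun_upd_apply)
    fix t w
    have row: "(\<Sum>j<Suc k. s ((w(k := t)) j) * L i j) = s t * L i k + (\<Sum>j<k. s (w j) * L i j)" for i
      by simp
    \<comment> \<open>Triangularity: the coordinates below \<open>k\<close> do not enter row
      \<open>k\<close>.\<close>
    have "(\<Sum>j<k. s (w j) * L k j) = 0" using Suc.prems(2) by simp
    then show "(\<Prod>i<k. g (b i + (\<Sum>j<Suc k. s ((w(k := t)) j) * L i j))) *
        g (b k + (\<Sum>j<Suc k. s ((w(k := t)) j) * L k j)) =
      g (b k + s t * L k k) * (\<Prod>i<k. g (b i + s t * L i k + (\<Sum>j<k. s (w j) * L i j)))"
      unfolding row by (simp add: add.assoc mult.commute)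
  qed
  also have "\<dots> = (\<Sum>t\<in>T. g (b k + s t * L k k) *
      (\<Sum>w\<in>PiE {..<k} (\<lambda>_. T). \<Prod>i<k. g ((b i + s t * L i k) + (\<Sum>j<k. s (w j) * L i j))))"
    by (simp add: sum.cartesian_product[symmetric] sum_distrib_left)
  also have "\<dots> \<le> (\<Sum>t\<in>T. g (b k + s t * L k k) * Q ^ k)"
    by (intro sum_mono mult_left_mono Suc.IH) (auto simp: g Suc.prems)
  also have "\<dots> \<le> Q * Q ^ k"
    unfolding sum_distrib_right[symmetric]
    by (intro mult_right_mono Suc.prems(1)) (use Q0 in auto)
  finally show ?case by simp
qed

text \<open>The 32 points have spacing at least \<open>\<delta> / 32\<close>, so at most two lie
  within less than \<open>\<delta> / 32\<close> of 0; these contribute at most 1 each. As 4096 = 4 *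
  32 * 32, every other term is at most \<open>exp (-4) \<le> 1 / 16\<close>, which adds at most 32 /
  16 = 2.\<close>

lemma spaced_gaussian_sum:
  fixes \<kappa> \<delta> l c :: real
  assumes "\<delta> > 0" "\<delta> \<le> l" "\<kappa> * \<delta>\<^sup>2 = 4096"
  shows "(\<Sum>t<(32::nat). exp (- \<kappa> * (c + real t / 32 * l)\<^sup>2)) \<le> 4"
proof -
  let ?N = "{t. t < (32::nat) \<and> \<bar>c + real t / 32 * l\<bar> < \<delta> / 32}"
  have \<kappa>: "\<kappa> > 0" using assms by (metis zero_less_mult_pos2 zero_less_power zero_less_numeral)
  \<comment> \<open>Indices two or more apart give values at least \<open>\<delta> / 16\<close>
    apart, the full width of the open window.\<close>
  have diff: "t \<le> t' + 1" if "t \<in> ?N" "t' \<in> ?N" for t t'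
  proof (rule ccontr)
    assume "\<not> t \<le> t' + 1"
    then have "real t - real t' \<ge> 2" by linarith
    then have "2 * \<delta> \<le> (real t - real t') * l" using assms by (intro mult_mono) auto
    moreover have "(real t - real t') * l = 32 * ((c + real t / 32 * l) - (c + real t' / 32 * l))"
      by (simp add: field_simps)
    moreover have "\<bar>c + real t / 32 * l\<bar> < \<delta> / 32" "\<bar>c + real t' / 32 * l\<bar> < \<delta> / 32"
      using that by auto
    moreover have False if "2 * \<delta> \<le> 32 * (x - y)" "\<bar>x\<bar> < \<delta> / 32" "\<bar>y\<bar> < \<delta> / 32" for x y :: real
    proof -
      have "x < \<delta> / 32" "- y < \<delta> / 32" using that by (simp_all only: abs_less_iff)
      then show False using that(1) by argo
    qed
    ultimately show False by metis
  qed
  have fN: "finite ?N" by simp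
  have cN: "card ?N \<le> 2"
  proof (cases "?N = {}")
    case False
    have "?N \<subseteq> {Min ?N, Suc (Min ?N)}"
    proof
      fix t assume "t \<in> ?N"
      then have "t \<le> Min ?N + 1" "Min ?N \<le> t"
        using diff[OF _ Min_in[OF fN False]] Min_le[OF fN] by blast+
      then have "t = Min ?N \<or> t = Suc (Min ?N)" by linarith
      then show "t \<in> {Min ?N, Suc (Min ?N)}" by blast
    qed
    then have "card ?N \<le> card {Min ?N, Suc (Min ?N)}" by (intro card_mono) auto
    then show ?thesis by simp
  next
    case True
    then show ?thesis by (simp only: True card.empty)
  qed
  have e4: "exp (-4::real) \<le> 1 / 16"
  proof -
    have "(2::real) ^ 4 \<le> exp 1 ^ 4" using exp_ge_add_one_self[of 1] by (intro power_mono) auto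
    then have "16 \<le> exp (4::real)" by (simp flip: exp_of_nat_mult)
    then show ?thesis by (simp add: exp_minus field_simps)
  qed
  have "(\<Sum>t<(32::nat). exp (- \<kappa> * (c + real t / 32 * l)\<^sup>2)) \<le> (\<Sum>t<(32::nat). (if t \<in> ?N then 1 else 0) + 1 / 16)"
  proof (rule sum_mono)
    fix t :: nat assume t: "t \<in> {..<32}"
    show "exp (- \<kappa> * (c + real t / 32 * l)\<^sup>2) \<le> (if t \<in> ?N then 1 else 0) + 1 / 16"
    proof (cases "t \<in> ?N")
      case True
      have "exp (- \<kappa> * (c + real t / 32 * l)\<^sup>2) \<le> 1" using \<kappa> by simp
      then have "exp (- \<kappa> * (c + real t / 32 * l)\<^sup>2) \<le> 1 + 1 / 16" by linarith
      then show ?thesis by (simp only: True if_True)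
    next
      case False
      then have "\<delta> / 32 \<le> \<bar>c + real t / 32 * l\<bar>" using t by auto
      then have "(\<delta> / 32)\<^sup>2 \<le> (c + real t / 32 * l)\<^sup>2"
        using assms(1) by (metis abs_le_square_iff abs_of_pos divide_pos_pos zero_less_numeral)
      then have "\<kappa> * (\<delta> / 32)\<^sup>2 \<le> \<kappa> * (c + real t / 32 * l)\<^sup>2" using \<kappa> by simp
      moreover have "\<kappa> * (\<delta> / 32)\<^sup>2 = 4" using assms(3) by (simp add: power_divide)
      ultimately have "exp (- \<kappa> * (c + real t / 32 * l)\<^sup>2) \<le> exp (-4)" by simp
      then have "exp (- \<kappa> * (c + real t / 32 * l)\<^sup>2) \<le> 0 + 1 / 16" using e4 by linarith
      then show ?thesis by (simp only: False if_False)
    qed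
  qed
  also have "\<dots> = real (card ?N) + 2"
  proof -
    have "(\<Sum>t<(32::nat). (if t \<in> ?N then 1 else 0)) = (\<Sum>t\<in>?N. 1::real)"
      by (rule sum.mono_neutral_cong_right) auto
    then show ?thesis by (simp only: sum.distrib) simp
  qed
  also have "\<dots> \<le> 4" using cN by linarith
  finally show ?thesis .
qed

text \<open>If every subset had a colouring of discrepancy at most \<open>D\<close>, each of the
  \<open>32 ^ k\<close> points \<open>w / 32\<close> of the cube would round to a 0/1 vertex
  \<open>y\<close> with Gaussian weight at least \<open>exp (- k)\<close>. Each of the
  \<open>2 ^ k\<close> vertices receives total weight at most \<open>4 ^ k\<close>. Hence
  \<open>32 ^ k \<le> (8 * exp 1) ^ k \<le> 24 ^ k\<close>, a contradiction.\<close>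

lemma triangular_system_discrepancy:
  fixes v :: "'c \<Rightarrow> 'q \<Rightarrow> real" and k :: nat
  assumes R: "finite R" and k: "k > 0" and \<delta>: "\<delta> > 0"
    and e: "orthonormal_on R {..<k} e"
    and tri: "\<And>i j. i < k \<Longrightarrow> j < i \<Longrightarrow> dotp R (v (c j)) (e i) = 0"
    and dia: "\<And>i. i < k \<Longrightarrow> \<delta> \<le> dotp R (v (c i)) (e i)"
    and D: "4096 * real (card R) * D\<^sup>2 \<le> real k * \<delta>\<^sup>2"
  shows "\<exists>S \<subseteq> c ` {..<k}. \<forall>x. (\<forall>j\<in>S. x j \<in> {-1, 1::int}) \<longrightarrow> (\<exists>q\<in>R. D < \<bar>\<Sum>j\<in>S. x j * v j q\<bar>)"
proof (rule ccontr)
  assume no: "\<not> ?thesis"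
  \<comment> \<open>A repeated column would be both zero and at least \<open>\<delta>\<close>
    against the same \<open>e i\<close>. Injectivity lets colourings of sets of columns be read as
    colourings of sets of indices.\<close>
  have inj: "inj_on c {..<k}"
  proof (rule inj_onI)
    have ne: "c j \<noteq> c i" if "j < i" "i < k" for i j
      using tri[OF that(2,1)] dia[OF that(2)] \<delta> by auto
    fix i j assume "i \<in> {..<k}" "j \<in> {..<k}" "c i = c j"
    then show "i = j"
      using ne[of i j] ne[of j i] by (cases i j rule: linorder_cases) auto
  qed
  have col: "\<exists>x. (\<forall>j\<in>S. x j \<in> {-1, 1::int}) \<and> (\<forall>q\<in>R. \<bar>\<Sum>j\<in>S. x j * v (c j) q\<bar> \<le> D)"
    if S: "S \<subseteq> {..<k}" for S
  proof -
    have "c ` S \<subseteq> c ` {..<k}" using S by blast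
    then obtain x where x: "\<forall>j\<in>c ` S. x j \<in> {-1, 1::int}" "\<forall>q\<in>R. \<bar>\<Sum>j\<in>c ` S. x j * v j q\<bar> \<le> D"
    proof -
      from \<open>c ` S \<subseteq> _\<close> no have "\<not> (\<forall>x. (\<forall>j\<in>c ` S. x j \<in> {-1, 1::int}) \<longrightarrow>
        (\<exists>q\<in>R. D < \<bar>\<Sum>j\<in>c ` S. x j * v j q\<bar>))" by blast
      then show thesis using that by (auto simp only: not_all not_imp bex_simps not_less)
    qed
    have "(\<Sum>j\<in>c ` S. x j * v j q) = (\<Sum>j\<in>S. x (c j) * v (c j) q)" for q
      using inj_on_subset[OF inj S] by (simp add: sum.reindex)
    with x show ?thesis by (intro exI[of _ "x \<circ> c"]) auto
  qed
  \<comment> \<open>This width meets the requirement of the Gaussian sum, and with the hypothesis on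
    \<open>D\<close> it keeps the exponent of a rounding error at most \<open>k\<close>.\<close>
  define \<kappa> where "\<kappa> = 4096 / \<delta>\<^sup>2"
  have \<kappa>: "\<kappa> > 0" "\<kappa> * \<delta>\<^sup>2 = 4096" using \<delta> by (auto simp: \<kappa>_def)
  have \<kappa>D: "\<kappa> * (real (card R) * D\<^sup>2) \<le> real k"
    using D \<delta> by (simp add: \<kappa>_def field_simps)
  define L where "L i j = dotp R (v (c j)) (e i)" for i j
  define W where "W = PiE {..<k} (\<lambda>_. {..<32::nat})"
  define Y where "Y = PiE {..<k} (\<lambda>_. {..<2::nat})"
  \<comment> \<open>The inner expression is the \<open>i\<close>-th coordinate, in the basis
    \<open>e\<close>, of the error made by rounding \<open>w / 32\<close> to
    \<open>y\<close>.\<close>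
  define G where "G y w = (\<Prod>i<k. exp (- \<kappa> * (- (\<Sum>j<k. real (y j) * L i j) + (\<Sum>j<k. real (w j) / 32 * L i j))\<^sup>2))"
    for y w :: "nat \<Rightarrow> nat"
  have fin: "finite W" "finite Y" by (auto simp: W_def Y_def intro!: finite_PiE)
  have upper: "(\<Sum>w\<in>W. G y w) \<le> 4 ^ k" for y
    unfolding G_def W_def
    using spaced_gaussian_sum[OF \<delta> _ \<kappa>(2)] dia tri
    by (intro triangular_sum_bound[where s = "\<lambda>t. real t / 32"]) (auto simp: L_def)
  have lower: "\<exists>y\<in>Y. exp (- real k) \<le> G y w" if w: "w \<in> W" for w
  proof -
    have "w j \<le> 2 ^ 5" if "j \<in> {..<k}" for j using w that by (auto simp: W_def dest!: PiE_mem)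
    \<comment> \<open>Five binary digits, as 32 = \<open>2 ^ 5\<close>.\<close>
    from dyadic_rounding[where J = "{..<k}" and r = 5 and w = w, OF finite_lessThan col this]
    obtain y where y: "\<And>j. j < k \<Longrightarrow> y j \<le> (1::nat)"
      and yD: "\<And>q. q \<in> R \<Longrightarrow> \<bar>\<Sum>j<k. (w j / 32 - y j) * v (c j) q\<bar> \<le> D * (31 / 32)"
      by (auto simp: lessThan_def)
    define z where "z q = (\<Sum>j<k. (w j / 32 - y j) * v (c j) q)" for q
    have zD: "(z q)\<^sup>2 \<le> D\<^sup>2" if "q \<in> R" for q
    proof -
      have "\<bar>z q\<bar> \<le> \<bar>D\<bar>" using yD[OF that] by (simp add: z_def)
      then show ?thesis by (simp add: abs_le_square_iff)
    qed
    have "dotp R z (e i) = (\<Sum>j<k. (w j / 32 - y j) * L i j)" for i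
      by (simp add: z_def[abs_def] dotp_sum_left dotp_scale_left L_def)
    then have ze: "dotp R z (e i) = - (\<Sum>j<k. real (y j) * L i j) + (\<Sum>j<k. real (w j) / 32 * L i j)" for i
      by (simp add: left_diff_distrib sum_subtractf)
    \<comment> \<open>Bessel turns the bound on each row of the error into a bound on its
      coordinates along \<open>e\<close>.\<close>
    have "(\<Sum>i<k. (dotp R z (e i))\<^sup>2) \<le> dotp R z z" by (intro bessel e) simp
    also have "\<dots> \<le> real (card R) * D\<^sup>2"
      unfolding dotp_def using sum_mono[of R "\<lambda>q. z q * z q" "\<lambda>_. D\<^sup>2"] zD by (simp add: power2_eq_square)
    finally have "\<kappa> * (\<Sum>i<k. (dotp R z (e i))\<^sup>2) \<le> real k"
      using \<kappa>D \<kappa>(1) by (meson mult_left_mono order_trans less_imp_le)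
    then have "exp (- real k) \<le> exp (\<Sum>i<k. - \<kappa> * (dotp R z (e i))\<^sup>2)"
      by (simp add: sum_distrib_left sum_negf)
    also have "\<dots> = G y w" by (simp only: exp_sum[OF finite_lessThan] G_def ze)
    also have "\<dots> = G (restrict y {..<k}) w" by (simp add: G_def)
    finally show ?thesis using y by (intro bexI[of _ "restrict y {..<k}"]) (auto simp: Y_def le_imp_less_Suc numeral_2_eq_2)
  qed
  have G0: "0 \<le> G y w" for y w by (simp add: G_def prod_nonneg)
  have "32 ^ k * exp (- real k) = (\<Sum>w\<in>W. exp (- real k))"
    by (simp add: W_def card_PiE)
  also have "\<dots> \<le> (\<Sum>w\<in>W. \<Sum>y\<in>Y. G y w)"
  proof (rule sum_mono)
    fix w assume "w \<in> W"
    then obtain y where "y \<in> Y" "exp (- real k) \<le> G y w" using lower by blast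
    then show "exp (- real k) \<le> (\<Sum>y\<in>Y. G y w)"
      using member_le_sum[of y Y "\<lambda>y. G y w"] G0 fin(2) by force
  qed
  also have "\<dots> = (\<Sum>y\<in>Y. \<Sum>w\<in>W. G y w)" by (rule sum.swap)
  also have "\<dots> \<le> (\<Sum>y\<in>Y. 4 ^ k)" by (intro sum_mono upper)
  also have "\<dots> = 8 ^ k" by (simp add: Y_def card_PiE flip: power_mult_distrib)
  finally have "32 ^ k \<le> 8 ^ k * exp (real k)" by (simp add: exp_minus field_simps)
  also have "\<dots> = (8 * exp 1) ^ k" by (simp add: power_mult_distrib flip: exp_of_nat_mult)
  also have "\<dots> \<le> 24 ^ k" using exp_le by (intro power_mono) auto
  finally show False using power_strict_mono[of "24::real" 32 k] k by simp
qed

subsection \<open>The threshold matrix and its singular vectors\<close>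

lemma sin_times_sum_cos:
  "2 * sin (\<theta> / 2) * (\<Sum>t<n. cos (\<theta> * real t + \<phi>)) = sin (\<theta> * (real n - 1 / 2) + \<phi>) - sin (\<phi> - \<theta> / 2)"
proof (induction n)
  case 0
  then show ?case by (simp add: field_simps)
next
  case (Suc n)
  have "2 * sin (\<theta> / 2) * cos x = sin (x + \<theta> / 2) - sin (x - \<theta> / 2)" for x
    by (simp add: sin_add sin_diff)
  from this[of "\<theta> * real n + \<phi>"] Suc.IH show ?case
    by (simp add: algebra_simps)
qed

text \<open>In the telescoped sum the two end points differ by \<open>m\<close> full turns, and the
  factor \<open>sin (pi * m / M)\<close> is nonzero because \<open>M\<close> does not divide
  \<open>m\<close>.\<close>

lemma sum_cos_eq_0:
  fixes m :: int
  assumes "M > 0" "\<not> int M dvd m"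
  shows "(\<Sum>t<M. cos (2 * pi * m / M * real t + \<phi>)) = 0"
proof -
  let ?\<theta> = "2 * pi * m / M"
  have "sin (?\<theta> / 2) \<noteq> 0"
  proof
    assume "sin (?\<theta> / 2) = 0"
    then obtain i :: int where "?\<theta> / 2 = of_int i * pi" by (auto simp: sin_zero_iff_int2)
    then have "of_int m = (of_int (int M * i) :: real)" using assms(1) by (simp add: field_simps)
    then have "m = int M * i" by (simp only: of_int_eq_iff)
    then show False using assms(2) by simp
  qed
  moreover have "?\<theta> * (real M - 1 / 2) + \<phi> = (\<phi> - ?\<theta> / 2) + 2 * pi * m"
    using assms(1) by (simp add: field_simps)
  then have "sin (?\<theta> * (real M - 1 / 2) + \<phi>) = sin (\<phi> - ?\<theta> / 2)"
    by (simp only: sin_add sin_int_2pin cos_int_2pin mult_1_right mult_zero_right add_0_right)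
  ultimately show ?thesis using sin_times_sum_cos[of ?\<theta> \<phi> M] by simp
qed

text \<open>Sums and differences of odd frequencies are even, so each sum runs over full periods
  with \<open>m = x + y + 1\<close> or \<open>m = x - y\<close>. Both have absolute value below
  \<open>M\<close>, and only the difference can vanish.\<close>

lemma sum_cos_odd_frequencies:
  assumes "odd \<xi>" "odd \<eta>" "\<xi> < M" "\<eta> < M"
  shows "(\<Sum>t<M. cos (pi * real \<xi> * (real t + \<alpha>) / M - pi * real \<eta> * (real t + \<alpha>) / M)) = (if \<xi> = \<eta> then real M else 0)"
    and "(\<Sum>t<M. cos (pi * real \<xi> * (real t + \<alpha>) / M + pi * real \<eta> * (real t + \<alpha>) / M)) = 0"
proof -
  have M: "M > 0" using assms by simp
  obtain x y where xy: "\<xi> = 2 * x + 1" "\<eta> = 2 * y + 1" using assms by (auto elim!: oddE)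
  show "(\<Sum>t<M. cos (pi * real \<xi> * (real t + \<alpha>) / M - pi * real \<eta> * (real t + \<alpha>) / M)) = (if \<xi> = \<eta> then real M else 0)"
  proof (cases "\<xi> = \<eta>")
    case False
    let ?m = "int x - int y"
    have "\<not> int M dvd ?m"
      using zdvd_not_zless[of ?m "int M"] zdvd_not_zless[of "- ?m" "int M"] assms xy False by fastforce
    from sum_cos_eq_0[OF M this, of "2 * pi * ?m / M * \<alpha>"] show ?thesis
      using False by (simp add: xy field_simps)
  qed simp
  have "\<not> int M dvd (int x + int y + 1)"
    using zdvd_not_zless[of "int x + int y + 1" "int M"] assms xy by linarith
  from sum_cos_eq_0[OF M this, of "2 * pi * (int x + int y + 1) / M * \<alpha>"]
  show "(\<Sum>t<M. cos (pi * real \<xi> * (real t + \<alpha>) / M + pi * real \<eta> * (real t + \<alpha>) / M)) = 0"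
    by (simp add: xy field_simps)
qed

text \<open>The summands \<open>0\<close> and \<open>- 1 / 2\<close> are the phases \<open>\<alpha>\<close> of the preceding lemma.\<close>

definition cos_mode :: "nat \<Rightarrow> nat \<Rightarrow> nat \<Rightarrow> real" where
  "cos_mode M \<xi> t = sqrt (2 / M) * cos (pi * real \<xi> * (real t + 0) / M)"

definition sin_mode :: "nat \<Rightarrow> nat \<Rightarrow> nat \<Rightarrow> real" where
  "sin_mode M \<xi> s = sqrt (2 / M) * sin (pi * real \<xi> * (real s + (- 1 / 2)) / M)"

definition odd_freqs :: "nat \<Rightarrow> nat set" where
  "odd_freqs M = {\<xi>. odd \<xi> \<and> \<xi> < M}"

text \<open>With values 1 and -1 the entry depends on \<open>t - s\<close> and extends to a function
  that changes sign under a shift by \<open>M\<close>. Waves of odd frequency have the same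
  antiperiodicity, so they diagonalise the matrix.\<close>

definition threshold_sign :: "nat \<Rightarrow> nat \<Rightarrow> real" where
  "threshold_sign s t = (if s \<le> t then 1 else - 1)"

lemma orthonormal_cos_mode: "orthonormal_on {..<M} (odd_freqs M) (cos_mode M)"
  unfolding orthonormal_on_def
proof (intro ballI)
  fix \<xi> \<eta> assume *: "\<xi> \<in> odd_freqs M" "\<eta> \<in> odd_freqs M"
  then have f: "odd \<xi>" "odd \<eta>" "\<xi> < M" "\<eta> < M" and M: "M > 0" by (auto simp: odd_freqs_def)
  have "dotp {..<M} (cos_mode M \<xi>) (cos_mode M \<eta>) = (\<Sum>t<M. (2 / M) *
    (cos (pi * real \<xi> * (real t + 0) / M) * cos (pi * real \<eta> * (real t + 0) / M)))"
    unfolding dotp_def cos_mode_def using M by (intro sum.cong refl) (simp add: field_simps)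
  also have "\<dots> = (2 / M) * (((\<Sum>t<M. cos (pi * real \<xi> * (real t + 0) / M - pi * real \<eta> * (real t + 0) / M))
    + (\<Sum>t<M. cos (pi * real \<xi> * (real t + 0) / M + pi * real \<eta> * (real t + 0) / M))) / 2)"
    unfolding cos_times_cos by (simp only: sum_distrib_left[symmetric] sum_divide_distrib[symmetric] sum.distrib)
  also have "\<dots> = (if \<xi> = \<eta> then 1 else 0)"
    unfolding sum_cos_odd_frequencies[OF f] using M by simp
  finally show "dotp {..<M} (cos_mode M \<xi>) (cos_mode M \<eta>) = (if \<xi> = \<eta> then 1 else 0)" .
qed

lemma orthonormal_sin_mode: "orthonormal_on {..<M} (odd_freqs M) (sin_mode M)"
  unfolding orthonormal_on_def
proof (intro ballI)
  fix \<xi> \<eta> assume *: "\<xi> \<in> odd_freqs M" "\<eta> \<in> odd_freqs M"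
  then have f: "odd \<xi>" "odd \<eta>" "\<xi> < M" "\<eta> < M" and M: "M > 0" by (auto simp: odd_freqs_def)
  let ?a = "- 1 / 2 :: real"
  have "dotp {..<M} (sin_mode M \<xi>) (sin_mode M \<eta>) = (\<Sum>t<M. (2 / M) *
    (sin (pi * real \<xi> * (real t + ?a) / M) * sin (pi * real \<eta> * (real t + ?a) / M)))"
    unfolding dotp_def sin_mode_def using M by (intro sum.cong refl) (simp add: field_simps)
  also have "\<dots> = (2 / M) * (((\<Sum>t<M. cos (pi * real \<xi> * (real t + ?a) / M - pi * real \<eta> * (real t + ?a) / M))
    - (\<Sum>t<M. cos (pi * real \<xi> * (real t + ?a) / M + pi * real \<eta> * (real t + ?a) / M))) / 2)"
    unfolding sin_times_sin by (simp only: sum_distrib_left[symmetric] sum_divide_distrib[symmetric] sum_subtractf)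
  also have "\<dots> = (if \<xi> = \<eta> then 1 else 0)"
    unfolding sum_cos_odd_frequencies[OF f] using M by simp
  finally show "dotp {..<M} (sin_mode M \<xi>) (sin_mode M \<eta>) = (if \<xi> = \<eta> then 1 else 0)" .
qed

text \<open>Used to bound the singular value \<open>1 / sin (pi * \<xi> / M / 2)\<close> below by
  \<open>M / (2 * \<xi>)\<close>.\<close>

lemma sin_half_frequency_bounds:
  assumes "\<xi> \<in> odd_freqs M"
  shows "0 < sin (pi * real \<xi> / M / 2)" and "sin (pi * real \<xi> / M / 2) \<le> 2 * real \<xi> / M"
proof -
  have M: "M > 0" "0 < \<xi>" "\<xi> < M" using assms by (auto simp: odd_freqs_def intro: odd_pos)
  show "0 < sin (pi * real \<xi> / M / 2)"
    using M by (intro sin_gt_zero) (auto simp: field_simps)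
  have "sin (pi * real \<xi> / M / 2) \<le> pi * real \<xi> / M / 2" by (intro sin_x_le_x) simp
  also have "\<dots> \<le> 4 * real \<xi> / M / 2" using pi_less_4 by (intro divide_right_mono mult_right_mono) auto
  finally show "sin (pi * real \<xi> / M / 2) \<le> 2 * real \<xi> / M" by simp
qed

text \<open>The signed sum is the full cosine sum minus twice its first \<open>s\<close> terms. For
  odd \<open>\<xi>\<close> the constant end-point terms cancel, leaving a sine at
  \<open>s - 1 / 2\<close>; this is the source of the half-step phase in
  \<open>sin_mode\<close>.\<close>

lemma threshold_sign_cos_mode:
  assumes \<xi>: "\<xi> \<in> odd_freqs M" and s: "s < M"
  shows "dotp {..<M} (threshold_sign s) (cos_mode M \<xi>) = - 1 / sin (pi * real \<xi> / M / 2) * sin_mode M \<xi> s"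
proof -
  let ?\<theta> = "pi * real \<xi> / M"
  have M: "M > 0" using s by simp
  have u: "cos_mode M \<xi> t = sqrt (2 / M) * cos (?\<theta> * real t + 0)" for t by (simp add: cos_mode_def)
  have h: "sin_mode M \<xi> s = sqrt (2 / M) * sin (?\<theta> * (real s - 1 / 2) + 0)" by (simp add: sin_mode_def)
  have split: "(\<Sum>t<M. (if s \<le> t then 1 else - 1) * f t) = (\<Sum>t<M. f t) - 2 * (\<Sum>t<s. f t)" for f :: "nat \<Rightarrow> real"
  proof -
    have "(\<Sum>t<M. (if s \<le> t then 1 else - 1) * f t) = (\<Sum>t<M. f t - (if t < s then 2 * f t else 0))"
      by (intro sum.cong) auto
    also have "\<dots> = (\<Sum>t<M. f t) - (\<Sum>t<s. 2 * f t)"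
      unfolding sum_subtractf using s
      by (intro arg_cong2[of _ _ _ _ "(-)"] refl sum.mono_neutral_cong_right) auto
    finally show ?thesis by (simp add: sum_distrib_left)
  qed
  have "2 * sin (?\<theta> / 2) * (\<Sum>t<M. threshold_sign s t * cos (?\<theta> * real t + 0)) =
    2 * sin (?\<theta> / 2) * (\<Sum>t<M. cos (?\<theta> * real t + 0)) - 2 * (2 * sin (?\<theta> / 2) * (\<Sum>t<s. cos (?\<theta> * real t + 0)))"
    unfolding threshold_sign_def split by (simp only: right_diff_distrib mult.left_commute)
  also have "\<dots> = sin (?\<theta> * (real M - 1 / 2)) - sin (- (?\<theta> / 2)) - 2 * (sin (?\<theta> * (real s - 1 / 2)) - sin (- (?\<theta> / 2)))"
    unfolding sin_times_sum_cos by simp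
  also have "?\<theta> * (real M - 1 / 2) = pi * real \<xi> - ?\<theta> / 2" using M by (simp add: field_simps)
  also have "sin (pi * real \<xi> - ?\<theta> / 2) = sin (?\<theta> / 2)"
    using \<xi> by (auto simp: sin_diff odd_freqs_def mult.commute[of pi "real \<xi>"] simp del: sin_npi2)
  finally have "sin (?\<theta> / 2) * (\<Sum>t<M. threshold_sign s t * cos (?\<theta> * real t + 0)) = - sin (?\<theta> * (real s - 1 / 2))"
    by simp
  then have "(\<Sum>t<M. threshold_sign s t * cos (?\<theta> * real t + 0)) = - 1 / sin (?\<theta> / 2) * sin (?\<theta> * (real s - 1 / 2))"
    using sin_half_frequency_bounds(1)[OF \<xi>] by (simp add: field_simps)
  moreover have "dotp {..<M} (threshold_sign s) (cos_mode M \<xi>) =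
      sqrt (2 / M) * (\<Sum>t<M. threshold_sign s t * cos (?\<theta> * real t + 0))"
    unfolding dotp_def u by (simp add: sum_distrib_left mult_ac)
  ultimately show ?thesis by (simp add: h)
qed

section \<open>Tensor powers of one-dimensional families\<close>

lemma dotp_PiE_prod:
  assumes "finite I" "\<And>i. i \<in> I \<Longrightarrow> finite (A i)"
  shows "dotp (PiE I A) (\<lambda>p. \<Prod>i\<in>I. f i (p i)) (\<lambda>p. \<Prod>i\<in>I. g i (p i)) = (\<Prod>i\<in>I. dotp (A i) (f i) (g i))"
  unfolding dotp_def using assms by (subst prod_sum_PiE) (auto simp: prod.distrib)

lemma orthonormal_on_PiE_prod:
  assumes "finite I" "finite A" "orthonormal_on A J e"
  shows "orthonormal_on (PiE I (\<lambda>_. A)) (PiE I (\<lambda>_. J)) (\<lambda>\<xi> p. \<Prod>i\<in>I. e (\<xi> i) (p i))"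
  unfolding orthonormal_on_def
proof (intro ballI)
  fix \<xi> \<eta> assume *: "\<xi> \<in> PiE I (\<lambda>_. J)" "\<eta> \<in> PiE I (\<lambda>_. J)"
  have "dotp (PiE I (\<lambda>_. A)) (\<lambda>p. \<Prod>i\<in>I. e (\<xi> i) (p i)) (\<lambda>p. \<Prod>i\<in>I. e (\<eta> i) (p i)) =
    (\<Prod>i\<in>I. if \<xi> i = \<eta> i then 1 else 0)"
    using assms * by (subst dotp_PiE_prod) (auto simp: orthonormal_on_def PiE_mem intro!: prod.cong)
  also have "\<dots> = (if \<xi> = \<eta> then 1 else 0)"
  proof (cases "\<xi> = \<eta>")
    case False
    then obtain i where "i \<in> I" "\<xi> i \<noteq> \<eta> i" using * by (meson PiE_ext)
    then show ?thesis using False assms(1) by (auto intro!: prod_zero bexI[of _ i])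
  qed simp
  finally show "dotp (PiE I (\<lambda>_. A)) (\<lambda>p. \<Prod>i\<in>I. e (\<xi> i) (p i)) (\<lambda>p. \<Prod>i\<in>I. e (\<eta> i) (p i)) =
    (if \<xi> = \<eta> then 1 else 0)" .
qed

section \<open>Counting tuples of odd frequencies with bounded product\<close>

lemma card_odd_dyadic:
  assumes "l \<ge> 1"
  shows "card {\<xi>::nat. odd \<xi> \<and> 2 ^ l \<le> \<xi> \<and> \<xi> < 2 ^ Suc l} = 2 ^ (l - 1)"
proof -
  obtain m where l: "l = Suc m" using assms by (cases l) auto
  have "{\<xi>::nat. odd \<xi> \<and> 2 ^ l \<le> \<xi> \<and> \<xi> < 2 ^ Suc l} = (\<lambda>x. 2 * x + 1) ` {2 ^ m..<2 ^ Suc m}"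
    unfolding l by (auto elim!: oddE)
  then show ?thesis by (simp add: card_image inj_on_def l)
qed

definition hyperbolic_cross :: "nat \<Rightarrow> nat \<Rightarrow> (nat \<Rightarrow> nat) set" where
  "hyperbolic_cross d M = {\<xi> \<in> PiE {..<d} (\<lambda>_. odd_freqs M). (\<Prod>i<d. \<xi> i) \<le> M}"

lemma dyadic_level_unique:
  assumes "(2::nat) ^ a \<le> x" "x < 2 ^ Suc a" "2 ^ b \<le> x" "x < 2 ^ Suc b"
  shows "a = b"
proof -
  have "(2::nat) ^ a < 2 ^ Suc b" "(2::nat) ^ b < 2 ^ Suc a" using assms by linarith+
  then have "a < Suc b" "b < Suc a" by (simp_all only: power_strict_increasing_iff semiring_norm)
  then show ?thesis by simp
qed

text \<open>There are \<open>s ^ (d - 1)\<close> disjoint dyadic blocks inside the cross. A block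
  whose levels sum to \<open>d * s\<close> contains \<open>2 ^ (d * s - d)\<close> odd tuples, which
  is \<open>M / 4 ^ d\<close>.\<close>

lemma card_hyperbolic_cross:
  assumes d: "d \<ge> 1" and s: "s \<ge> 1" and M: "M = 2 ^ (d * (s + 1))"
  shows "s ^ (d - 1) * M \<le> 4 ^ d * card (hyperbolic_cross d M)"
proof -
  \<comment> \<open>The levels of coordinates \<open>1..<d\<close> range freely over \<open>{1..s}\<close>; coordinate \<open>0\<close> takes up the slack, so that all
    levels sum to \<open>d * s\<close> and every dyadic block \<open>B l\<close> has the same cardinality.\<close>
  define E where "E = PiE {1..<d} (\<lambda>_. {1..s})"
  define f where "f l i = (if i = 0 then d * s - (\<Sum>i\<in>{1..<d}. l i) else l i)" for l :: "nat \<Rightarrow> nat" and i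
  define A where "A a = {\<xi>::nat. odd \<xi> \<and> 2 ^ a \<le> \<xi> \<and> \<xi> < 2 ^ Suc a}" for a
  define B where "B l = PiE {..<d} (\<lambda>i. A (f l i))" for l
  have ins: "{..<d} = insert 0 {1..<d}" using d by auto
  \<comment> \<open>At least \<open>s\<close> is left for coordinate 0, so the subtraction in
    \<open>f\<close> does not truncate and all levels are positive.\<close>
  have suml: "(\<Sum>i\<in>{1..<d}. l i) + s \<le> d * s" if "l \<in> E" for l
  proof -
    have "(\<Sum>i\<in>{1..<d}. l i) \<le> (\<Sum>i\<in>{1..<d}. s)"
      using that by (intro sum_mono) (auto simp: E_def dest: PiE_mem)
    then show ?thesis using d by (cases d) auto
  qed
  have f1: "f l i \<ge> 1" if "l \<in> E" "i < d" for l i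
    using suml[OF that(1)] s that by (cases "i = 0") (auto simp: f_def E_def dest: PiE_mem)
  have sumf: "(\<Sum>i<d. f l i) = d * s" if "l \<in> E" for l
  proof -
    have "(\<Sum>i<d. f l i) = f l 0 + (\<Sum>i\<in>{1..<d}. l i)"
      unfolding ins by (simp add: f_def)
    then show ?thesis using suml[OF that] by (simp add: f_def)
  qed
  have cardA: "2 * card (A a) = 2 ^ a" if "a \<ge> 1" for a
    using card_odd_dyadic[OF that] that by (cases a) (auto simp: A_def)
  have finA: "finite (A a)" for a by (simp add: A_def)
  have finB: "finite (B l)" for l by (auto simp: B_def finA intro!: finite_PiE)
  have cardB: "4 ^ d * card (B l) = M" if "l \<in> E" for l
  proof -
    have "2 ^ d * card (B l) = (\<Prod>i<d. 2 * card (A (f l i)))"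
      by (simp add: B_def card_PiE prod.distrib)
    also have "\<dots> = (\<Prod>i<d. 2 ^ f l i)" using f1[OF that] cardA by simp
    also have "\<dots> = 2 ^ (d * s)" by (simp add: sumf[OF that] flip: power_sum)
    finally have "2 ^ d * (2 ^ d * card (B l)) = M" by (simp add: M flip: power_add)
    moreover have "(4::nat) ^ d = 2 ^ d * 2 ^ d" by (simp flip: power_mult_distrib)
    ultimately show ?thesis by simp
  qed
  have Bsub: "B l \<subseteq> hyperbolic_cross d M" if l: "l \<in> E" for l
  proof
    fix \<xi> assume \<xi>: "\<xi> \<in> B l"
    have A: "\<xi> i \<in> A (f l i)" if "i < d" for i using \<xi> that by (auto simp: B_def dest: PiE_mem)
    \<comment> \<open>The upper ends of the dyadic intervals multiply to exactly \<open>M\<close>,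
      which explains the exponent \<open>d * (s + 1)\<close>.\<close>
    have "(\<Prod>i<d. \<xi> i) \<le> (\<Prod>i<d. 2 ^ Suc (f l i))"
      using A by (intro prod_mono) (auto simp: A_def intro: less_imp_le)
    also have "\<dots> = 2 ^ (\<Sum>i<d. Suc (f l i))" by (simp only: power_sum)
    also have "(\<Sum>i<d. Suc (f l i)) = d * (s + 1)" using sumf[OF l] by (simp add: sum_Suc)
    finally have prod: "(\<Prod>i<d. \<xi> i) \<le> M" by (simp add: M)
    have "\<xi> i \<in> odd_freqs M" if i: "i < d" for i
    proof -
      have "f l i \<le> (\<Sum>i<d. f l i)" using i by (intro member_le_sum) auto
      then have "Suc (f l i) \<le> d * (s + 1)" using sumf[OF l] d by simp
      then have "(2::nat) ^ Suc (f l i) \<le> M" unfolding M by (intro power_increasing) auto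
      then show ?thesis using A[OF i] by (auto simp: A_def odd_freqs_def)
    qed
    then show "\<xi> \<in> hyperbolic_cross d M"
      using \<xi> prod by (auto simp: hyperbolic_cross_def B_def PiE_def)
  qed
  have disj: "B l \<inter> B l' = {}" if l: "l \<in> E" "l' \<in> E" "l \<noteq> l'" for l l'
  proof (rule ccontr)
    assume "B l \<inter> B l' \<noteq> {}"
    then obtain \<xi> where \<xi>: "\<xi> \<in> B l" "\<xi> \<in> B l'" by blast
    have "l i = l' i" if i: "i \<in> {1..<d}" for i
    proof -
      have "\<xi> i \<in> A (f l i)" "\<xi> i \<in> A (f l' i)"
        using \<xi> i by (auto simp: B_def dest!: PiE_mem[of _ _ _ i])
      then have "f l i = f l' i" by (auto simp: A_def intro: dyadic_level_unique[of _ "\<xi> i"])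
      then show ?thesis using i by (simp add: f_def)
    qed
    then show False using l PiE_ext unfolding E_def by blast
  qed
  have finE: "finite E" by (auto simp: E_def intro!: finite_PiE)
  have finH: "finite (hyperbolic_cross d M)"
  proof (rule finite_subset)
    show "hyperbolic_cross d M \<subseteq> PiE {..<d} (\<lambda>_. {..<M})"
      by (auto simp: hyperbolic_cross_def odd_freqs_def PiE_def Pi_def)
  qed (auto intro!: finite_PiE)
  have "s ^ (d - 1) * M = (\<Sum>l\<in>E. 4 ^ d * card (B l))"
    using cardB by (simp add: E_def card_PiE)
  also have "\<dots> = 4 ^ d * card (\<Union>l\<in>E. B l)"
    using finE finB disj by (subst card_UN_disjoint) (auto simp: sum_distrib_left)
  also have "\<dots> \<le> 4 ^ d * card (hyperbolic_cross d M)"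
    using Bsub finH by (intro mult_left_mono card_mono) auto
  finally show ?thesis .
qed

section \<open>Discrepancy of the tensor sign matrix on the grid\<close>

lemma grid_sign_discrepancy:
  assumes d: "d \<ge> 1" and s: "s \<ge> 1" and M: "M = 2 ^ (d * (s + 1))"
  defines "G \<equiv> PiE {..<d} (\<lambda>_. {..<M})"
  shows "\<exists>S\<subseteq>G. \<forall>x. (\<forall>p\<in>S. x p \<in> {-1, 1::int}) \<longrightarrow>
    (\<exists>q\<in>G. real s ^ (d - 1) / (128 * 8 ^ d) < \<bar>\<Sum>p\<in>S. x p * (\<Prod>i<d. threshold_sign (q i) (p i))\<bar>)"
proof -
  define F where "F = hyperbolic_cross d M"
  define K where "K = card F"
  define n where "n = M ^ d"
  \<comment> \<open>The product of the bounds \<open>M / (2 * \<xi> i)\<close> when the frequencies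
    multiply to at most \<open>M\<close>.\<close>
  define \<sigma> where "\<sigma> = real M ^ d / (2 ^ d * M)"
  \<comment> \<open>Chosen so that \<open>n * \<delta>\<^sup>2 = \<sigma>\<^sup>2 * K / 2\<close>,
    the Frobenius mass left after removing at most \<open>K / 2\<close> dimensions.\<close>
  define \<delta> where "\<delta> = sqrt (\<sigma>\<^sup>2 * K / (2 * n))"
  \<comment> \<open>Rounded up: \<open>k \<ge> K / 2\<close>, while any \<open>i < k\<close> still
    satisfies \<open>i \<le> K / 2\<close>.\<close>
  define k where "k = (K + 1) div 2"
  define v where "v p q = (\<Prod>i<d. threshold_sign (q i) (p i))" for p q :: "nat \<Rightarrow> nat"
  define lam where "lam \<xi> = (\<Prod>i<d. - 1 / sin (pi * real (\<xi> i) / M / 2))" for \<xi> :: "nat \<Rightarrow> nat"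
  define u where "u \<xi> p = (\<Prod>i<d. cos_mode M (\<xi> i) (p i))" for \<xi> p :: "nat \<Rightarrow> nat"
  define h where "h \<xi> p = (\<Prod>i<d. sin_mode M (\<xi> i) (p i))" for \<xi> p :: "nat \<Rightarrow> nat"
  have M0: "M > 0" by (simp add: M)
  have G: "finite G" "card G = n" "G \<noteq> {}"
    using M0 by (auto simp: G_def n_def card_PiE PiE_eq_empty_iff intro!: finite_PiE)
  have n0: "n > 0" using M0 by (simp add: n_def)
  have cK: "s ^ (d - 1) * M \<le> 4 ^ d * K" unfolding K_def F_def by (rule card_hyperbolic_cross[OF d s M])
  have "0 < s ^ (d - 1) * M" using s M0 by simp
  with cK have K0: "K > 0" by (metis mult_0_right not_gr_zero not_le)
  then have finF: "finite F" by (simp add: K_def card_gt_0_iff)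
  have Fsub: "F \<subseteq> PiE {..<d} (\<lambda>_. odd_freqs M)" by (auto simp: F_def hyperbolic_cross_def)
  have \<sigma>0: "\<sigma> > 0" using M0 by (simp add: \<sigma>_def)
  have \<delta>0: "\<delta> > 0" using K0 n0 \<sigma>0 by (simp add: \<delta>_def)
  have \<delta>2: "\<delta>\<^sup>2 = \<sigma>\<^sup>2 * K / (2 * n)" by (simp add: \<delta>_def)
  have sub: "orthonormal_on A J e \<Longrightarrow> J' \<subseteq> J \<Longrightarrow> orthonormal_on A J' e" for A J J' and e :: "(nat \<Rightarrow> nat) \<Rightarrow> (nat \<Rightarrow> nat) \<Rightarrow> real"
    unfolding orthonormal_on_def by (meson subsetD)
  have onu: "orthonormal_on G F u"
    unfolding G_def u_def[abs_def]
    by (rule sub[OF orthonormal_on_PiE_prod[OF _ _ orthonormal_cos_mode] Fsub]) auto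
  have onh: "orthonormal_on G F h"
    unfolding G_def h_def[abs_def]
    by (rule sub[OF orthonormal_on_PiE_prod[OF _ _ orthonormal_sin_mode] Fsub]) auto
  \<comment> \<open>Matrix and modes are products over the coordinates, so the one-dimensional
    identity multiplies up.\<close>
  have eig: "dotp G (\<lambda>p. v p q) (u \<xi>) = lam \<xi> * h \<xi> q" if "\<xi> \<in> F" "q \<in> G" for \<xi> q
  proof -
    have "\<xi> i \<in> odd_freqs M" "q i < M" if "i < d" for i
      using \<open>\<xi> \<in> F\<close> \<open>q \<in> G\<close> that Fsub by (auto simp: G_def dest: PiE_mem)
    then show ?thesis
      unfolding G_def v_def u_def[abs_def] lam_def h_def
      by (subst dotp_PiE_prod) (simp_all add: threshold_sign_cos_mode flip: prod.distrib)
  qed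
  have lam: "\<sigma> \<le> \<bar>lam \<xi>\<bar>" if "\<xi> \<in> F" for \<xi>
  proof -
    have odd: "\<xi> i \<in> odd_freqs M" if "i < d" for i
      using \<open>\<xi> \<in> F\<close> that Fsub by (auto dest: PiE_mem)
    then have pos: "0 < \<xi> i" if "i < d" for i using that by (auto simp: odd_freqs_def intro!: odd_pos)
    have "\<sigma> \<le> real M ^ d / (2 ^ d * real (\<Prod>i<d. \<xi> i))"
      using that M0 pos unfolding \<sigma>_def
      by (intro divide_left_mono mult_left_mono mult_pos_pos)
        (auto simp: F_def hyperbolic_cross_def simp flip: of_nat_prod intro!: prod_pos)
    also have "\<dots> = (\<Prod>i<d. real M / (2 * real (\<xi> i)))"
      by (simp add: prod_dividef prod.distrib)
    also have "\<dots> \<le> (\<Prod>i<d. \<bar>- 1 / sin (pi * real (\<xi> i) / M / 2)\<bar>)"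
    proof (intro prod_mono conjI)
      fix i assume i: "i \<in> {..<d}"
      note b = sin_half_frequency_bounds[OF odd, of i]
      have "real M / (2 * real (\<xi> i)) = 1 / (2 * real (\<xi> i) / M)" by simp
      also have "\<dots> \<le> 1 / sin (pi * real (\<xi> i) / M / 2)"
        using b i pos M0 by (intro divide_left_mono) auto
      also have "\<dots> = \<bar>- 1 / sin (pi * real (\<xi> i) / M / 2)\<bar>"
        using b(1) i by simp
      finally show "real M / (2 * real (\<xi> i)) \<le> \<bar>- 1 / sin (pi * real (\<xi> i) / M / 2)\<bar>" .
    qed simp
    also have "\<dots> = \<bar>lam \<xi>\<bar>" by (simp only: lam_def abs_prod)
    finally show ?thesis .
  qed
  have "\<exists>c e. c ` {..<k} \<subseteq> G \<and> orthonormal_on G {..<k} e \<and>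
    (\<forall>i<k. \<forall>j<i. dotp G (v (c j)) (e i) = 0) \<and> (\<forall>i<k. \<delta> \<le> dotp G (v (c i)) (e i))"
  proof (rule greedy_triangular_system[OF G(1,3) \<delta>0])
    fix i and e :: "nat \<Rightarrow> (nat \<Rightarrow> nat) \<Rightarrow> real"
    assume i: "i < k" and e: "orthonormal_on G {..<i} e"
    have "real (card G) * \<delta>\<^sup>2 = \<sigma>\<^sup>2 * (K / 2)" using n0 by (simp add: G(2) \<delta>2)
    also have "\<dots> \<le> \<sigma>\<^sup>2 * (real (card F) - real (card {..<i}))"
      using i by (intro mult_left_mono) (auto simp: k_def K_def[symmetric])
    also have "\<dots> \<le> (\<Sum>p\<in>G. dotp G (residual G {..<i} e (v p)) (residual G {..<i} e (v p)))"
      using spectral_residual_bound[OF finF _ onu onh e eig _ lam] \<sigma>0 by simp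
    finally show "real (card G) * \<delta>\<^sup>2 \<le> (\<Sum>p\<in>G. dotp G (residual G {..<i} e (v p)) (residual G {..<i} e (v p)))" .
  qed
  then obtain c e where "c ` {..<k} \<subseteq> G \<and> orthonormal_on G {..<k} e \<and>
    (\<forall>i<k. \<forall>j<i. dotp G (v (c j)) (e i) = 0) \<and> (\<forall>i<k. \<delta> \<le> dotp G (v (c i)) (e i))"
    by (elim exE)
  then have ce: "c ` {..<k} \<subseteq> G" "orthonormal_on G {..<k} e"
    "\<And>i j. i < k \<Longrightarrow> j < i \<Longrightarrow> dotp G (v (c j)) (e i) = 0" "\<And>i. i < k \<Longrightarrow> \<delta> \<le> dotp G (v (c i)) (e i)"
    by simp_all
  define D where "D = real s ^ (d - 1) / (128 * 8 ^ d)"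
  have D0: "D \<ge> 0" by (simp add: D_def)
  \<comment> \<open>The requirement
    \<open>4096 * n * D\<^sup>2 \<le> (K / 2) * \<delta>\<^sup>2\<close> is exactly this bound, as
    128 * 128 = 4 * 4096. The factor \<open>8 ^ d\<close> combines \<open>4 ^ d\<close> from the
    count \<open>K\<close> with \<open>2 ^ d\<close> from \<open>\<sigma>\<close>.\<close>
  have "D \<le> K * \<sigma> / (128 * n)"
  proof -
    have "real (s ^ (d - 1) * M) \<le> real (4 ^ d * K)" using cK by (simp only: of_nat_le_iff)
    then have "real s ^ (d - 1) * M \<le> 4 ^ d * K" by simp
    then have "real s ^ (d - 1) * M / (128 * 8 ^ d * M) \<le> 4 ^ d * K / (128 * 8 ^ d * M)"
      by (intro divide_right_mono) auto
    moreover have "real s ^ (d - 1) * M / (128 * 8 ^ d * M) = D" using M0 by (simp add: D_def)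
    moreover have "4 ^ d * K / (128 * 8 ^ d * M) = K * \<sigma> / (128 * n)"
    proof -
      have "(8::real) ^ d = 4 ^ d * 2 ^ d" by (simp flip: power_mult_distrib)
      then show ?thesis using M0 by (simp add: \<sigma>_def n_def)
    qed
    ultimately show ?thesis by simp
  qed
  then have "D\<^sup>2 \<le> (K * \<sigma> / (128 * n))\<^sup>2" using D0 by (intro power_mono) auto
  then have "4096 * real n * D\<^sup>2 \<le> 4096 * real n * (K * \<sigma> / (128 * n))\<^sup>2" by (intro mult_left_mono) auto
  also have "\<dots> = real K / 2 * \<delta>\<^sup>2" unfolding \<delta>2 using n0 by (simp add: power2_eq_square field_simps)
  also have "\<dots> \<le> real k * \<delta>\<^sup>2" by (intro mult_right_mono) (auto simp: k_def)
  finally have "4096 * real (card G) * D\<^sup>2 \<le> real k * \<delta>\<^sup>2" by (simp add: G(2))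
  moreover have "k > 0" using K0 by (simp add: k_def)
  ultimately have "\<exists>S\<subseteq>c ` {..<k}. \<forall>x. (\<forall>j\<in>S. x j \<in> {-1, 1::int}) \<longrightarrow> (\<exists>q\<in>G. D < \<bar>\<Sum>j\<in>S. x j * v j q\<bar>)"
    by (intro triangular_system_discrepancy[where v = v and c = c, OF G(1) _ \<delta>0 ce(2-4)])
  then obtain S where S: "S \<subseteq> c ` {..<k}"
    "\<forall>x. (\<forall>j\<in>S. x j \<in> {-1, 1::int}) \<longrightarrow> (\<exists>q\<in>G. D < \<bar>\<Sum>j\<in>S. x j * v j q\<bar>)"
    by (elim exE conjE)
  from S(1) ce(1) have "S \<subseteq> G" by (rule order_trans)
  with S(2) show ?thesis unfolding D_def v_def by (intro exI[of _ S] conjI)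
qed

subsection \<open>Boxes\<close>

text \<open>Each factor is the indicator of \<open>q i \<le> p i\<close> minus that of
  \<open>p i < q i\<close>; expanding the product gives a signed sum of \<open>2 ^ d\<close> box
  indicators.\<close>

lemma prod_threshold_sign_le_boxes:
  fixes x :: "(nat \<Rightarrow> nat) \<Rightarrow> real"
  assumes S: "S \<subseteq> PiE {..<d} (\<lambda>_. {..<M})"
    and B: "\<And>a b :: nat \<Rightarrow> real. \<bar>\<Sum>p | p \<in> S \<and> (\<forall>i<d. a i \<le> real (p i) \<and> real (p i) \<le> b i). x p\<bar> \<le> B"
  shows "\<bar>\<Sum>p\<in>S. x p * (\<Prod>i<d. threshold_sign (q i) (p i))\<bar> \<le> 2 ^ d * B"
proof -
  have finS: "finite S" by (rule finite_subset[OF S]) (auto intro!: finite_PiE)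
  \<comment> \<open>On the grid -1 and \<open>M\<close> act as infinite bounds, and the strict
    \<open>p i < q i\<close> becomes \<open>p i \<le> q i - 1\<close> on integers.\<close>
  define lo where "lo \<beta> i = (if \<beta> i then real (q i) else - 1)" for \<beta> :: "nat \<Rightarrow> bool" and i
  define hi where "hi \<beta> i = (if \<beta> i then real M else real (q i) - 1)" for \<beta> :: "nat \<Rightarrow> bool" and i
  define sg where "sg \<beta> = (\<Prod>i<d. if \<beta> i then 1 else - 1 :: real)" for \<beta> :: "nat \<Rightarrow> bool"
  define \<B> where "\<B> = PiE {..<d} (\<lambda>_. UNIV :: bool set)"
  define In where "In \<beta> p \<longleftrightarrow> (\<forall>i<d. lo \<beta> i \<le> real (p i) \<and> real (p i) \<le> hi \<beta> i)" for \<beta> and p :: "nat \<Rightarrow> nat"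
  have expand: "(\<Prod>i<d. threshold_sign (q i) (p i)) = (\<Sum>\<beta>\<in>\<B>. sg \<beta> * (if In \<beta> p then 1 else 0))" if "p \<in> S" for p
  proof -
    let ?g = "\<lambda>i b. (if b then 1 else - 1) *
      (if (if b then real (q i) else - 1) \<le> real (p i) \<and> real (p i) \<le> (if b then real M else real (q i) - 1) then 1 else 0 :: real)"
    have "threshold_sign (q i) (p i) = (\<Sum>b\<in>UNIV. ?g i b)" if "i < d" for i
    proof -
      have "p i < M" using \<open>p \<in> S\<close> S that by (auto dest: PiE_mem)
      then show ?thesis by (auto simp: threshold_sign_def UNIV_bool)
    qed
    then have "(\<Prod>i<d. threshold_sign (q i) (p i)) = (\<Prod>i<d. \<Sum>b\<in>UNIV. ?g i b)" by simp
    also have "\<dots> = (\<Sum>\<beta>\<in>\<B>. \<Prod>i<d. ?g i (\<beta> i))"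
      unfolding \<B>_def by (rule prod_sum_PiE) auto
    also have "\<dots> = (\<Sum>\<beta>\<in>\<B>. sg \<beta> * (\<Prod>i<d. if lo \<beta> i \<le> real (p i) \<and> real (p i) \<le> hi \<beta> i then 1 else 0))"
      unfolding prod.distrib sg_def lo_def hi_def ..
    also have "\<dots> = (\<Sum>\<beta>\<in>\<B>. sg \<beta> * (if In \<beta> p then 1 else 0))"
    proof (intro sum.cong refl arg_cong2[of _ _ _ _ "(*)"])
      fix \<beta>
      show "(\<Prod>i<d. if lo \<beta> i \<le> real (p i) \<and> real (p i) \<le> hi \<beta> i then 1 else 0 :: real) = (if In \<beta> p then 1 else 0)"
      proof (cases "In \<beta> p")
        case False
        then show ?thesis by (auto simp: In_def intro!: prod_zero)
      qed (auto simp: In_def intro!: prod.neutral)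
    qed
    finally show ?thesis .
  qed
  have "(\<Sum>p\<in>S. x p * (\<Prod>i<d. threshold_sign (q i) (p i))) =
    (\<Sum>p\<in>S. \<Sum>\<beta>\<in>\<B>. sg \<beta> * (if In \<beta> p then x p else 0))"
    by (auto simp: expand sum_distrib_left intro!: sum.cong)
  also have "\<dots> = (\<Sum>\<beta>\<in>\<B>. sg \<beta> * (\<Sum>p | p \<in> S \<and> In \<beta> p. x p))"
    by (subst sum.swap) (simp add: sum_distrib_left[symmetric] sum.inter_filter[OF finS])
  finally have "\<bar>\<Sum>p\<in>S. x p * (\<Prod>i<d. threshold_sign (q i) (p i))\<bar> \<le>
    (\<Sum>\<beta>\<in>\<B>. \<bar>sg \<beta> * (\<Sum>p | p \<in> S \<and> In \<beta> p. x p)\<bar>)" by simp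
  also have "\<dots> \<le> (\<Sum>\<beta>\<in>\<B>. B)"
  proof (rule sum_mono)
    fix \<beta>
    have "\<bar>sg \<beta>\<bar> = 1" unfolding sg_def abs_prod by (intro prod.neutral) auto
    then show "\<bar>sg \<beta> * (\<Sum>p | p \<in> S \<and> In \<beta> p. x p)\<bar> \<le> B"
      using B[of "lo \<beta>" "hi \<beta>"] by (simp add: abs_mult In_def)
  qed
  also have "\<dots> = 2 ^ d * B" by (simp add: \<B>_def card_PiE)
  finally show ?thesis .
qed

lemma points_with_large_box_discrepancy:
  assumes d: "d \<ge> 1" and s: "s \<ge> 1"
  shows "\<exists>P. P \<subseteq> pts d \<and> finite P \<and> card P \<le> 2 ^ (d * (s + 1) * d) \<and>
    (\<forall>x. (\<forall>p\<in>P. x p \<in> {-1, 1::int}) \<longrightarrow>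
      (\<exists>T\<in>rect_system d P. real s ^ (d - 1) / (128 * 16 ^ d) \<le> \<bar>real_of_int (\<Sum>p\<in>T. x p)\<bar>))"
proof -
  define M :: nat where "M = 2 ^ (d * (s + 1))"
  define G where "G = PiE {..<d} (\<lambda>_. {..<M})"
  define B where "B = real s ^ (d - 1) / (128 * 16 ^ d)"
  obtain S where S: "S \<subseteq> G" and disc: "\<And>x. (\<forall>p\<in>S. x p \<in> {-1, 1::int}) \<Longrightarrow>
    \<exists>q\<in>G. real s ^ (d - 1) / (128 * 8 ^ d) < \<bar>\<Sum>p\<in>S. x p * (\<Prod>i<d. threshold_sign (q i) (p i))\<bar>"
    using grid_sign_discrepancy[OF d s M_def] unfolding G_def by blast
  \<comment> \<open>Grid functions are \<open>undefined\<close> outside \<open>{..<d}\<close>,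
    whereas \<open>pts d\<close> requires 0 there.\<close>
  define emb where "emb p = (\<lambda>i. if i < d then real (p i) else 0)" for p :: "nat \<Rightarrow> nat"
  have finG: "finite G" by (auto simp: G_def intro!: finite_PiE)
  then have finS: "finite S" using S finite_subset by blast
  have inj: "inj_on emb S"
  proof (rule inj_onI)
    fix p p' assume p: "p \<in> S" "p' \<in> S" and eq: "emb p = emb p'"
    have "p i = p' i" if "i < d" for i using fun_cong[OF eq, of i] that by (simp add: emb_def)
    then show "p = p'" using p S unfolding G_def by (intro PiE_ext[of p "{..<d}" _ p']) auto
  qed
  have card: "card (emb ` S) \<le> 2 ^ (d * (s + 1) * d)"
  proof -
    have "card (emb ` S) \<le> card G" using card_image_le[OF finS] card_mono[OF finG S] by (rule order_trans)
    also have "\<dots> = 2 ^ (d * (s + 1) * d)" by (simp add: G_def card_PiE M_def power_mult)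
    finally show ?thesis .
  qed
  have "\<exists>T\<in>rect_system d (emb ` S). B \<le> \<bar>real_of_int (\<Sum>p\<in>T. x p)\<bar>"
    if x: "\<forall>p\<in>emb ` S. x p \<in> {-1, 1::int}" for x
  proof (rule ccontr)
    assume "\<not> ?thesis"
    then have "\<forall>T\<in>rect_system d (emb ` S). \<bar>real_of_int (\<Sum>p\<in>T. x p)\<bar> < B"
      by (simp only: bex_simps not_le)
    moreover have "axis_box d a b \<inter> emb ` S \<in> rect_system d (emb ` S)" for a b
      unfolding rect_system_def by blast
    ultimately have small: "\<bar>real_of_int (\<Sum>p\<in>axis_box d a b \<inter> emb ` S. x p)\<bar> < B" for a b
      by (rule bspec)
    have "\<bar>\<Sum>p | p \<in> S \<and> (\<forall>i<d. a i \<le> real (p i) \<and> real (p i) \<le> b i). real_of_int (x (emb p))\<bar> \<le> B" for a b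
    proof -
      let ?T = "{p \<in> S. \<forall>i<d. a i \<le> real (p i) \<and> real (p i) \<le> b i}"
      have "axis_box d a b \<inter> emb ` S = emb ` ?T"
        by (auto simp: axis_box_def pts_def emb_def)
      then have "(\<Sum>p\<in>axis_box d a b \<inter> emb ` S. x p) = (\<Sum>p\<in>?T. x (emb p))"
        using inj_on_subset[OF inj, of ?T] by (simp add: sum.reindex)
      then show ?thesis using small[of a b] by simp
    qed
    then have "\<bar>\<Sum>p\<in>S. real_of_int (x (emb p)) * (\<Prod>i<d. threshold_sign (q i) (p i))\<bar> \<le> 2 ^ d * B" for q
      using S unfolding G_def by (intro prod_threshold_sign_le_boxes)
    \<comment> \<open>Passing from sign vectors to boxes costs the factor \<open>2 ^ d\<close>,
      turning \<open>8 ^ d\<close> into \<open>16 ^ d\<close>.\<close>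
    moreover have "2 ^ d * B = real s ^ (d - 1) / (128 * 8 ^ d)"
    proof -
      have "(16::real) ^ d = 2 ^ d * 8 ^ d" by (simp flip: power_mult_distrib)
      then show ?thesis by (simp add: B_def)
    qed
    ultimately show False using disc[of "x \<circ> emb"] x by (auto simp: not_le[symmetric])
  qed
  moreover have "emb ` S \<subseteq> pts d" by (auto simp: emb_def pts_def)
  ultimately show ?thesis using finS card unfolding B_def by (intro exI[of _ "emb ` S"]) auto
qed

section \<open>From all colourings to \<open>disc\<close>, and the logarithmic bound\<close>

lemma disc_geI:
  assumes "finite V" "\<And>S. S \<in> F \<Longrightarrow> S \<subseteq> V"
    and "\<And>x. \<forall>v\<in>V. x v \<in> {-1, 1::int} \<Longrightarrow> \<exists>S\<in>F. B \<le> \<bar>real_of_int (\<Sum>v\<in>S. x v)\<bar>"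
  shows "B \<le> disc V F"
  unfolding disc_def
proof (rule cINF_greatest)
  show "{x. \<forall>v\<in>V. x v \<in> {-1, 1::int}} \<noteq> {}" 
    unfolding ex_in_conv[symmetric] by (rule exI[of _ "\<lambda>_. 1"]) simp
  fix x assume "x \<in> {x. \<forall>v\<in>V. x v \<in> {-1, 1::int}}"
  then have "\<forall>v\<in>V. x v \<in> {-1, 1::int}" by simp
  from assms(3)[OF this] obtain S where "S \<in> F" "B \<le> \<bar>real_of_int (\<Sum>v\<in>S. x v)\<bar>" by (elim bexE)
  \<comment> \<open>Finiteness makes the real supremum bounded above, so it dominates the value at
    \<open>S\<close>.\<close>
  moreover have "finite F" by (rule finite_subset[of F "Pow V"]) (use assms(1,2) in auto)
  ultimately show "B \<le> (SUP S\<in>F. \<bar>real_of_int (\<Sum>v\<in>S. x v)\<bar>)"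
    by (intro cSUP_upper2[of _ _ S]) auto
qed

theorem theorem1p1:
  fixes d :: nat
  assumes "d \<ge> 2"
  shows "\<exists>c>0. \<exists>\<^sub>\<infinity>n::nat. \<exists>P. P \<subseteq> pts d \<and> finite P \<and> card P = n \<and>
           disc P (rect_system d P) \<ge> c * (ln (real n)) ^ (d - 1)"
proof -
  \<comment> \<open>Below, \<open>ln (card P) \<le> 2 * d\<^sup>2 * s\<close>; this \<open>c\<close>
    makes \<open>c * (2 * d\<^sup>2 * s) ^ (d - 1)\<close> equal to \<open>B\<close>.\<close>
  define c :: real where "c = 1 / (128 * 16 ^ d * (2 * (real d)\<^sup>2) ^ (d - 1))"
  have d0: "d > 0" and d1: "d \<ge> 1" using assms by simp_all
  have "\<exists>n>m. \<exists>P. P \<subseteq> pts d \<and> finite P \<and> card P = n \<and>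
           disc P (rect_system d P) \<ge> c * (ln (real n)) ^ (d - 1)" for m
  proof -
    \<comment> \<open>Since \<open>d - 1 \<ge> 1\<close>, this size forces
      \<open>B \<ge> Suc m\<close>.\<close>
    define s where "s = Suc m * (128 * 16 ^ d)"
    define B where "B = real s ^ (d - 1) / (128 * 16 ^ d)"
    have s1: "s \<ge> 1" by (simp add: s_def Suc_le_eq)
    obtain P where "P \<subseteq> pts d \<and> finite P \<and> card P \<le> 2 ^ (d * (s + 1) * d) \<and>
      (\<forall>x. (\<forall>p\<in>P. x p \<in> {-1, 1::int}) \<longrightarrow> (\<exists>T\<in>rect_system d P. B \<le> \<bar>real_of_int (\<Sum>p\<in>T. x p)\<bar>))"
      using points_with_large_box_discrepancy[OF d1 s1] unfolding B_def by (elim exE)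
    then have P: "P \<subseteq> pts d" "finite P" and cP: "card P \<le> 2 ^ (d * (s + 1) * d)"
      and dP: "\<And>x. \<forall>p\<in>P. x p \<in> {-1, 1::int} \<Longrightarrow> \<exists>T\<in>rect_system d P. B \<le> \<bar>real_of_int (\<Sum>p\<in>T. x p)\<bar>"
      by blast+
    have sub: "T \<subseteq> P" if "T \<in> rect_system d P" for T using that by (auto simp: rect_system_def)
    have B: "B \<le> disc P (rect_system d P)" by (rule disc_geI[OF P(2) sub dP])
    have "real s = real (Suc m) * (128 * 16 ^ d)"
      by (simp only: s_def of_nat_mult of_nat_power of_nat_numeral)
    then have "real (Suc m) = real s ^ 1 / (128 * 16 ^ d)"
      by (simp only: power_one_right nonzero_mult_div_cancel_right[of "128 * 16 ^ d :: real"]) simp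
    also have "\<dots> \<le> B" unfolding B_def
      using s1 assms by (intro divide_right_mono power_increasing) auto
    \<comment> \<open>The constant colouring 1 has discrepancy at most \<open>card P\<close>, so a
      large \<open>B\<close> forces more than \<open>m\<close> points. This yields infinitely many
      \<open>n\<close> although \<open>card P\<close> was only bounded above.\<close>
    also have "B \<le> real (card P)"
    proof -
      obtain T where T: "T \<in> rect_system d P" "B \<le> \<bar>real_of_int (\<Sum>p\<in>T. 1)\<bar>"
        using dP[of "\<lambda>_. 1"] by (elim bexE meta_impE) simp_all
      then show ?thesis using card_mono[OF P(2) sub[OF T(1)]] by simp
    qed
    finally have m: "m < card P" by linarith
    have "real (card P) \<le> real (2 ^ (d * (s + 1) * d))" using cP by (simp only: of_nat_le_iff)
    then have "real (card P) \<le> 2 ^ (d * (s + 1) * d)" by (simp only: of_nat_power of_nat_numeral)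
    then have "ln (real (card P)) \<le> ln (2 ^ (d * (s + 1) * d))"
      using m by (intro ln_mono) simp_all
    also have "\<dots> = real (d * (s + 1) * d) * ln 2" by (rule ln_realpow)
    also have "\<dots> \<le> real (d * (s + 1) * d) * 1" using ln_2_less_1 by (intro mult_left_mono) auto
    also have "\<dots> \<le> 2 * (real d)\<^sup>2 * real s"
    proof -
      have "d * (s + 1) * d \<le> d * (2 * s) * d" using s1 by (intro mult_le_mono) auto
      then have "real (d * (s + 1) * d) \<le> real (d * (2 * s) * d)" by (simp only: of_nat_le_iff)
      then show ?thesis by (simp add: power2_eq_square mult_ac)
    qed
    finally have "ln (real (card P)) ^ (d - 1) \<le> (2 * (real d)\<^sup>2 * real s) ^ (d - 1)"
      using m by (intro power_mono) auto
    then have "c * ln (real (card P)) ^ (d - 1) \<le> c * (2 * (real d)\<^sup>2 * real s) ^ (d - 1)"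
      by (intro mult_left_mono) (auto simp: c_def)
    also have "\<dots> = B" using d0 by (simp add: c_def B_def power_mult_distrib)
    finally show ?thesis using B P m by (intro exI[of _ "card P"] conjI exI[of _ P]) auto
  qed
  moreover have "c > 0" using d0 by (simp add: c_def)
  ultimately show ?thesis unfolding INFM_nat by (intro exI[of _ c] conjI allI)
qed

end
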